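(* Let $k$ be a positive integer. For every sufficiently large prime $p\ge p_0(k)$ there is a set $A\subseteq\mathbb{Z}_p^2$ with $kp-k+1$ elements which is a $g$-Sidon set for $g=\lfloor k^2+2k^{3/2}\rfloor$.
   Context: For $A\subseteq\mathbb{Z}_p^2$ (the additive group $(\mathbb{Z}/p\mathbb{Z})^2$), the representation function is $r(x)=\#\{(a_1,a_2): a_1,a_2\in A,\ a_1+a_2=x\}$ (ordered pairs). $A$ is a $g$-Sidon set if $r(x)\le g$ for all $x$. *)

theory Defs
  imports Complex_Main "HOL-Algebra.Elementary_Groups" "HOL-Computational_Algebra.Primes"
begin

text \<open>
  HOL-Algebra writes groups multiplicatively: \<open>\<otimes>\<close> in \<open>integer_mod_group p\<close> is addition modulo \<open>p\<close>
  on the representatives \<open>{0..<p}\<close>, so \<open>a \<otimes> b\<close> below is the sum \<open>a + b\<close> of the mathematics.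
\<close>

definition Zp_squared :: "nat \<Rightarrow> (int \<times> int) monoid" where
  "Zp_squared p = integer_mod_group p \<times>\<times> integer_mod_group p"

definition rep_pairs :: "('a, 'b) monoid_scheme \<Rightarrow> 'a set \<Rightarrow> 'a \<Rightarrow> ('a \<times> 'a) set" where
  "rep_pairs G A x = {(a, b). a \<in> A \<and> b \<in> A \<and> a \<otimes>\<^bsub>G\<^esub> b = x}"

text \<open>The finiteness conjunct excludes infinite sets of representations, whose \<open>card\<close> is \<open>0\<close>.\<close>

definition g_sidon :: "('a, 'b) monoid_scheme \<Rightarrow> nat \<Rightarrow> 'a set \<Rightarrow> bool" where
  "g_sidon G g A \<longleftrightarrow> A \<subseteq> carrier G \<and>
     (\<forall>x \<in> carrier G. finite (rep_pairs G A x) \<and> card (rep_pairs G A x) \<le> g)"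

end

theory Submission
  imports Defs "HOL-Number_Theory.Euler_Criterion" "HOL-Analysis.Convex"
begin

text \<open>
  The set \<open>A\<close> is the union of the parabolas \<open>c y = x\<^sup>2\<close> for \<open>c = t + 1, \<dots>, t + k\<close>. Writing \<open>chi\<close> for the
  Legendre symbol, a point \<open>(a, b)\<close> has \<open>1 + chi (c d ((c + d) b - a\<^sup>2))\<close> representations as a sum
  of points from the parabolas with parameters \<open>c\<close> and \<open>d\<close>. Hence \<open>r(a, b)\<close> is at most \<open>k\<^sup>2\<close> plus the
  sum over \<open>s\<close> of the absolute values of the \<open>2 k - 1\<close> convolutions
  \<open>\<Sum>u + v = s. chi ((t + u) (t + v))\<close>. On average over \<open>t\<close>, the sum of the squares of these
  convolutions is \<open>2 k\<^sup>2 - k + o(1)\<close>, because off the diagonal only complete sums of \<open>chi\<close> over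
  quartics occur; for a suitable \<open>t\<close>, Cauchy-Schwarz then gives the bound \<open>(2 k - 1) \<surd>k\<close>.

  For the quartics, a bound \<open>O(p powr (3/4))\<close> suffices and Weil's theorem is avoided. A Moebius map
  reduces them to \<open>S(m) = \<Sum>x. chi (x (x + 1) (x + m))\<close>. Substituting \<open>y = x / r\<close> in \<open>S(l)\<^sup>2\<close> gives
  a sum over \<open>r\<close> of such quartic sums, so \<open>S(l)\<^sup>2\<close> is bounded by \<open>2 \<Sum>m. \<bar>S(m)\<bar> + O(p)\<close>; and the second
  moment \<open>\<Sum>m. S(m)\<^sup>2 \<le> p\<^sup>2\<close> is elementary.
\<close>

text \<open>Group the left sum by the fibres of \<open>f\<close>. It will be applied to the cross
  ratio as a function of a multiplier, a map that is at most two-to-one.\<close>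

lemma sum_comp_le_card_fibres:
  fixes g :: "'b \<Rightarrow> int"
  assumes fin: "finite A" "finite B" and sub: "f ` A \<subseteq> B"
    and g: "\<And>y. y \<in> B \<Longrightarrow> 0 \<le> g y" and n: "\<And>y. y \<in> B \<Longrightarrow> card {x \<in> A. f x = y} \<le> n"
  shows "(\<Sum>x\<in>A. g (f x)) \<le> int n * (\<Sum>y\<in>B. g y)"
proof -
  have "(\<Sum>x\<in>A. g (f x)) = (\<Sum>y\<in>B. \<Sum>x\<in>{x \<in> A. f x = y}. g (f x))"
    using sum.group[OF fin sub, of "\<lambda>x. g (f x)"] by simp
  also have "\<dots> = (\<Sum>y\<in>B. int (card {x \<in> A. f x = y}) * g y)"
    by (intro sum.cong refl) simp
  also have "\<dots> \<le> (\<Sum>y\<in>B. int n * g y)"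
    by (intro sum_mono mult_right_mono g) (use n in auto)
  finally show ?thesis by (simp add: sum_distrib_left)
qed

subsection \<open>The Legendre symbol and reindexing modulo a prime\<close>

locale odd_prime_modulus =
  fixes p :: int
  assumes prime: "prime p" and gt2: "p > 2"
begin

abbreviation chi :: "int \<Rightarrow> int" where "chi x \<equiv> Legendre x p"

abbreviation Fp :: "int set" where "Fp \<equiv> {0..<p}"

text \<open>The inverse modulo \<open>p\<close> given by Fermat's little theorem; the value is not
  reduced to \<open>Fp\<close>.\<close>

definition inv_mod :: "int \<Rightarrow> int" where "inv_mod x = x ^ (nat p - 2)"

text \<open>Summands are functions on all integers; periodicity lets them be evaluated at unreduced
  arguments when a sum over \<open>Fp\<close> is reindexed.\<close>

definition periodic :: "(int \<Rightarrow> 'b) \<Rightarrow> bool" where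
  "periodic f \<longleftrightarrow> (\<forall>x y. [x = y] (mod p) \<longrightarrow> f x = f y)"

lemma prime_natE:
  obtains q where "p = int q" "prime q" "2 < q"
proof
  show "p = int (nat p)" "2 < nat p" using gt2 by auto
  then show "prime (nat p)" using prime by (metis prime_int_nat_transfer)
qed

lemma periodicD: "periodic f \<Longrightarrow> [x = y] (mod p) \<Longrightarrow> f x = f y"
  unfolding periodic_def by blast

lemma dvd_mult_iff: "p dvd a * b \<longleftrightarrow> p dvd a \<or> p dvd b"
  using prime by (rule prime_dvd_mult_iff)

lemma not_dvd_1: "\<not> p dvd 1"
  using gt2 by (simp add: zdvd_not_zless)

lemma residues_eqI: "x \<in> Fp \<Longrightarrow> y \<in> Fp \<Longrightarrow> p dvd x - y \<Longrightarrow> x = y"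
  by (simp flip: mod_eq_dvd_iff)

lemma nonzero_residue: "x \<in> Fp - {0} \<Longrightarrow> \<not> p dvd x"
  by (auto simp: zdvd_not_zless)

lemma residues_dvd_iff: "x \<in> Fp \<Longrightarrow> p dvd x \<longleftrightarrow> x = 0"
  using nonzero_residue[of x] by auto

lemma card_residues: "int (card Fp) = p"
  using gt2 by simp

lemma inv_mod: "\<not> p dvd x \<Longrightarrow> p dvd x * inv_mod x - 1"
proof -
  assume x: "\<not> p dvd x"
  obtain q where q: "p = int q" "prime q" "2 < q" by (rule prime_natE)
  have "[x ^ (q - 1) = 1] (mod int q)"
  proof -
    have y: "\<not> q dvd nat (x mod p)"
    proof
      assume "q dvd nat (x mod p)"
      then have "int q dvd int (nat (x mod p))" by (simp only: int_dvd_int_iff)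
      moreover have "int (nat (x mod p)) = x mod p" using gt2 by simp
      ultimately have "p dvd x mod p" using q by simp
      then show False using x by (simp add: dvd_mod_iff)
    qed
    have "[nat (x mod p) ^ (q - 1) = 1] (mod q)"
      using fermat_theorem[OF q(2) y] .
    then have "[int (nat (x mod p)) ^ (q - 1) = 1] (mod int q)"
      by (metis cong_int_iff of_nat_1 of_nat_power)
    moreover have "int (nat (x mod p)) = x mod p" using gt2 by simp
    ultimately show ?thesis using q
      by (simp add: cong_def power_mod)
  qed
  moreover have "q - 1 = Suc (q - 2)" using gt2 q by linarith
  ultimately have "[x * inv_mod x = 1] (mod p)"
    unfolding inv_mod_def using q(1) by simp
  then show ?thesis by (simp add: cong_iff_dvd_diff)
qed

lemma inv_mod_nonzero: "\<not> p dvd x \<Longrightarrow> \<not> p dvd inv_mod x"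
proof
  assume "\<not> p dvd x" "p dvd inv_mod x"
  then have "p dvd x * inv_mod x - (x * inv_mod x - 1)"
    by (intro dvd_diff inv_mod dvd_mult)
  then show False using not_dvd_1 by simp
qed

lemma chi_cong: "[x = y] (mod p) \<Longrightarrow> chi x = chi y"
  unfolding Legendre_def QuadRes_def by (simp add: cong_def)

lemma chi_dvd_cong: "p dvd x - y \<Longrightarrow> chi x = chi y"
  by (rule chi_cong) (simp add: cong_iff_dvd_diff)

lemma chi_eq_0_iff: "chi x = 0 \<longleftrightarrow> p dvd x"
  unfolding Legendre_def by (simp add: cong_0_iff)

lemma chi_cases: "chi x = 0 \<or> chi x = 1 \<or> chi x = -1"
  unfolding Legendre_def by simp

lemma abs_chi_le: "\<bar>chi x\<bar> \<le> 1"
  using chi_cases[of x] by auto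

lemma chi_square: "\<not> p dvd x \<Longrightarrow> chi x * chi x = 1"
  using chi_cases[of x] chi_eq_0_iff[of x] by auto

lemma chi_square_if: "chi x * chi x = (if p dvd x then 0 else 1)"
  using chi_square[of x] chi_eq_0_iff[of x] by auto

text \<open>Euler's criterion makes both sides congruent. Each is at most 1 in absolute value, so
  they differ by at most 2, which is less than \<open>p\<close>.\<close>

lemma chi_mult: "chi (x * y) = chi x * chi y"
proof -
  obtain q where q: "p = int q" "prime q" "2 < q" by (rule prime_natE)
  have e: "[chi z = z ^ ((q - 1) div 2)] (mod p)" for z
    using euler_criterion[OF q(2,3)] q(1) by simp
  have "[chi x * chi y = x ^ ((q - 1) div 2) * y ^ ((q - 1) div 2)] (mod p)"
    by (intro cong_mult e)
  moreover have "[chi (x * y) = x ^ ((q - 1) div 2) * y ^ ((q - 1) div 2)] (mod p)"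
    using e[of "x * y"] by (simp add: power_mult_distrib)
  ultimately have "[chi (x * y) = chi x * chi y] (mod p)"
    by (metis cong_sym cong_trans)
  then have d: "p dvd chi (x * y) - chi x * chi y" by (simp add: cong_iff_dvd_diff)
  have "\<bar>chi x * chi y\<bar> \<le> 1" using chi_cases[of x] chi_cases[of y] by auto
  then have "\<bar>chi (x * y) - chi x * chi y\<bar> < p"
    using abs_chi_le[of "x * y"] gt2 by linarith
  then show ?thesis using d dvd_imp_le_int[of "chi (x * y) - chi x * chi y" p] by fastforce
qed

lemma chi_1: "chi 1 = 1"
  using chi_mult[of 1 1] chi_eq_0_iff[of 1] not_dvd_1 by auto

lemma chi_inv_mod: "\<not> p dvd x \<Longrightarrow> chi (inv_mod x) = chi x"
proof -
  assume x: "\<not> p dvd x"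
  have "chi x * chi (inv_mod x) = 1"
    using chi_dvd_cong[OF inv_mod[OF x]] by (simp add: chi_mult chi_1)
  then show ?thesis using chi_cases[of x] by auto
qed

text \<open>After reduction modulo \<open>p\<close>, \<open>g\<close> is an injective self-map of a
  finite set, hence a permutation; periodicity of \<open>f\<close> makes the reduction
  invisible.\<close>

lemma sum_reindex_mod:
  fixes f :: "int \<Rightarrow> 'b::comm_monoid_add"
  assumes f: "periodic f" and A: "finite A" "\<And>x. x \<in> A \<Longrightarrow> g x mod p \<in> A"
    and inj: "\<And>x y. x \<in> A \<Longrightarrow> y \<in> A \<Longrightarrow> p dvd g x - g y \<Longrightarrow> x = y"
  shows "(\<Sum>x\<in>A. f (g x)) = (\<Sum>x\<in>A. f x)"
proof -
  have "inj_on (\<lambda>x. g x mod p) A"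
    using inj by (auto simp: inj_on_def mod_eq_dvd_iff)
  moreover have "(\<lambda>x. g x mod p) ` A = A"
    using A(2) by (intro endo_inj_surj A(1) calculation) auto
  ultimately have "(\<Sum>x\<in>A. f x) = (\<Sum>x\<in>A. f (g x mod p))"
    using sum.reindex[of "\<lambda>x. g x mod p" A f] by simp
  also have "\<dots> = (\<Sum>x\<in>A. f (g x))"
    by (intro sum.cong refl periodicD[OF f]) (simp add: cong_def)
  finally show ?thesis by simp
qed

lemma sum_affine:
  fixes f :: "int \<Rightarrow> 'b::comm_monoid_add"
  assumes f: "periodic f" and c: "\<not> p dvd c"
  shows "(\<Sum>x\<in>Fp. f (c * x + d)) = (\<Sum>x\<in>Fp. f x)"
proof (rule sum_reindex_mod[OF f])
  fix x y assume xy: "x \<in> Fp" "y \<in> Fp" "p dvd (c * x + d) - (c * y + d)"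
  then have "p dvd c * (x - y)" by (simp add: algebra_simps)
  then show "x = y" using c xy residues_eqI by (auto simp: dvd_mult_iff)
qed (use gt2 in auto)

lemma sum_shift:
  fixes f :: "int \<Rightarrow> 'b::comm_monoid_add"
  assumes f: "periodic f"
  shows "(\<Sum>x\<in>Fp. f (x + d)) = (\<Sum>x\<in>Fp. f x)"
  using sum_affine[OF f not_dvd_1, of d] by simp

lemma sum_nonzero_inv:
  fixes f :: "int \<Rightarrow> 'b::comm_monoid_add"
  assumes f: "periodic f" and c: "\<not> p dvd c"
  shows "(\<Sum>x\<in>Fp - {0}. f (inv_mod x * c)) = (\<Sum>x\<in>Fp - {0}. f x)"
proof (rule sum_reindex_mod[OF f])
  fix x assume x: "x \<in> Fp - {0}"
  then have "\<not> p dvd inv_mod x * c"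
    using c inv_mod_nonzero nonzero_residue by (auto simp: dvd_mult_iff)
  then show "inv_mod x * c mod p \<in> Fp - {0}" using gt2 by (auto simp: mod_eq_0_iff_dvd)
next
  fix x y assume xy: "x \<in> Fp - {0}" "y \<in> Fp - {0}"
    and d: "p dvd inv_mod x * c - inv_mod y * c"
  have "p dvd c * (inv_mod x - inv_mod y)" using d by (simp add: algebra_simps)
  then have *: "p dvd inv_mod x - inv_mod y" using c by (simp add: dvd_mult_iff)
  \<comment> \<open>This is \<open>x y (1/y - 1/x) = x - y\<close> with the errors of the two
    inverses written out.\<close>
  have "x - y = x * y * (inv_mod y - inv_mod x) + (x * inv_mod x - 1) * y - (y * inv_mod y - 1) * x"
    by (simp add: algebra_simps)
  moreover have "p dvd inv_mod y - inv_mod x" using * by (simp add: dvd_diff_commute)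
  moreover have "p dvd x * inv_mod x - 1" "p dvd y * inv_mod y - 1"
    using xy nonzero_residue inv_mod by blast+
  ultimately have "p dvd x - y"
    by (metis dvd_add dvd_diff dvd_mult dvd_mult2)
  then show "x = y" using residues_eqI xy by auto
qed auto

lemma periodic_chi: "(\<And>x y. [x = y] (mod p) \<Longrightarrow> [f x = f y] (mod p)) \<Longrightarrow> periodic (\<lambda>x. chi (f x))"
  unfolding periodic_def by (blast intro: chi_cong)

lemmas periodic_intros = periodic_chi cong_mult cong_add cong_refl

lemma sum_remove_zero:
  fixes f :: "int \<Rightarrow> 'b::comm_monoid_add"
  shows "(\<Sum>x\<in>Fp. f x) = f 0 + (\<Sum>x\<in>Fp - {0}. f x)"
  using gt2 by (intro sum.remove) auto

section \<open>Complete sums of \<open>chi\<close> over linear and quadratic polynomials\<close>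

text \<open>Otherwise squaring would map \<open>Fp\<close> onto itself and so be injective, although
  1 and \<open>p - 1\<close> are distinct with the same square.\<close>

lemma exists_nonresidue: "\<exists>n. chi n = -1"
proof (rule ccontr)
  assume no: "\<nexists>n. chi n = -1"
  have q: "\<exists>y\<in>Fp. y * y mod p = x" if x: "x \<in> Fp" for x
  proof (cases "x = 0")
    case True
    then show ?thesis using gt2 by (intro bexI[of _ 0]) auto
  next
    case False
    then have "chi x \<noteq> 0" using x chi_eq_0_iff residues_dvd_iff by blast
    then have "chi x = 1" using no chi_cases by blast
    then obtain y where "[y ^ 2 = x] (mod p)"
      by (auto simp: Legendre_def QuadRes_def split: if_splits)
    then have "(y mod p) * (y mod p) mod p = x"
      using x by (simp add: cong_def power2_eq_square mod_mult_eq)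
    then show ?thesis using gt2 by (intro bexI[of _ "y mod p"]) auto
  qed
  then have "Fp \<subseteq> (\<lambda>y. y * y mod p) ` Fp" by force
  then have "inj_on (\<lambda>y. y * y mod p) Fp"
    by (intro finite_surj_inj) auto
  moreover have "1 * 1 mod p = (p - 1) * (p - 1) mod p"
    by (simp add: mod_eq_dvd_iff algebra_simps)
  ultimately have "1 = p - 1"
    by (elim inj_onD) (use gt2 in auto)
  then show False using gt2 by simp
qed

text \<open>Multiplication by a nonresidue permutes the residues and changes the sign of the
  sum.\<close>

lemma sum_chi: "(\<Sum>x\<in>Fp. chi x) = 0"
proof -
  obtain n where n: "chi n = -1" using exists_nonresidue by blast
  then have "\<not> p dvd n" using chi_eq_0_iff[of n] by auto
  then have "(\<Sum>x\<in>Fp. chi (n * x + 0)) = (\<Sum>x\<in>Fp. chi x)"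
    by (intro sum_affine) (auto simp: periodic_def intro: chi_cong)
  then show ?thesis by (simp add: chi_mult n sum_negf)
qed

lemma chi_mult_self_left: "\<not> p dvd x \<Longrightarrow> chi x * (chi x * y) = y"
  using chi_square[of x] by (simp flip: mult.assoc)

lemma chi_pm1: "\<not> p dvd x \<Longrightarrow> chi x = 1 \<or> chi x = -1"
  using chi_cases[of x] chi_eq_0_iff[of x] by auto

lemma sum_nonzero: "(\<Sum>x\<in>Fp - {0}. f x) = (\<Sum>x\<in>Fp. f x) - (f 0 :: int)"
  by (simp add: sum_remove_zero)

text \<open>After a shift the polynomial is \<open>x (x + e)\<close> with \<open>e = b - a\<close>.
  If \<open>e\<close> vanishes modulo \<open>p\<close> it is a square. Otherwise division by
  \<open>x^2\<close> gives \<open>1 + e/x\<close>, and \<open>e/x\<close> runs through the nonzero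
  residues, so only minus the term \<open>chi 1\<close> remains.\<close>

lemma sum_chi_quadratic:
  "(\<Sum>x\<in>Fp. chi ((x + a) * (x + b))) = (if p dvd a - b then p - 1 else -1)"
proof -
  have per: "periodic (\<lambda>x. chi (x * (x + (b - a))))" by (intro periodic_intros)
  have "(\<Sum>x\<in>Fp. chi ((x + a) * (x + b))) = (\<Sum>x\<in>Fp. chi (x * (x + (b - a))))"
    using sum_shift[OF per, of a] by (simp add: algebra_simps)
  also have "\<dots> = (\<Sum>x\<in>Fp - {0}. chi (x * (x + (b - a))))"
    using chi_eq_0_iff[of 0] by (simp add: sum_remove_zero)
  also have "\<dots> = (if p dvd a - b then p - 1 else -1)"
  proof (cases "p dvd a - b")
    case True
    have "chi (x * (x + (b - a))) = 1" if x: "x \<in> Fp - {0}" for x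
    proof -
      have "chi (x + (b - a)) = chi x"
        using True by (intro chi_dvd_cong) (simp add: dvd_diff_commute)
      then show ?thesis using chi_square[OF nonzero_residue[OF x]] by (simp add: chi_mult)
    qed
    then show ?thesis using True card_residues gt2 by (simp add: of_nat_diff)
  next
    case False
    then have c: "\<not> p dvd b - a" by (simp add: dvd_diff_commute)
    have per': "periodic (\<lambda>y. chi (1 + y))" by (intro periodic_intros)
    have "chi (x * (x + (b - a))) = chi (1 + inv_mod x * (b - a))" if x: "x \<in> Fp - {0}" for x
    proof -
      note x' = nonzero_residue[OF x]
      have "x * (1 + inv_mod x * (b - a)) - (x + (b - a)) = (x * inv_mod x - 1) * (b - a)"
        by (simp add: algebra_simps)
      then have "chi (x * (1 + inv_mod x * (b - a))) = chi (x + (b - a))"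
        using inv_mod[OF x'] by (intro chi_dvd_cong) simp
      then show ?thesis using chi_pm1[OF x'] by (auto simp: chi_mult)
    qed
    then have "(\<Sum>x\<in>Fp - {0}. chi (x * (x + (b - a)))) = (\<Sum>y\<in>Fp - {0}. chi (1 + y))"
      using sum_nonzero_inv[OF per' c] by simp
    also have "\<dots> = (\<Sum>y\<in>Fp. chi (y + 1)) - 1"
      by (simp add: sum_nonzero chi_1 add.commute)
    also have "(\<Sum>y\<in>Fp. chi (y + 1)) = 0"
      using sum_shift[of chi 1] sum_chi by (auto simp: periodic_def intro: chi_cong)
    finally show ?thesis using False by simp
  qed
  finally show ?thesis .
qed

subsection \<open>Cubic and quartic character sums\<close>

text \<open>For \<open>m\<close> different from 0 and 1 modulo \<open>p\<close> this is, up to sign,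
  the trace of Frobenius of the elliptic curve \<open>y^2 = x (x + 1) (x + m)\<close>.\<close>

definition cubic_sum :: "int \<Rightarrow> int" where
  "cubic_sum m = (\<Sum>x\<in>Fp. chi (x * (x + 1) * (x + m)))"

definition quartic_sum :: "int \<Rightarrow> int \<Rightarrow> int \<Rightarrow> int \<Rightarrow> int" where
  "quartic_sum a b c d = (\<Sum>x\<in>Fp. chi ((x + a) * (x + b) * (x + c) * (x + d)))"

text \<open>Expand the square and sum over \<open>m\<close> first: the inner sums are quadratic, so
  the result is \<open>p\<close> times the diagonal minus a perfect square, which is
  dropped.\<close>

lemma sum_cubic_sum_squares: "(\<Sum>m\<in>Fp. cubic_sum m * cubic_sum m) \<le> p * p"
proof -
  define w where "w x = chi (x * (x + 1))" for x
  have "(\<Sum>m\<in>Fp. cubic_sum m * cubic_sum m)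
      = (\<Sum>m\<in>Fp. \<Sum>x\<in>Fp. \<Sum>y\<in>Fp. w x * w y * chi ((m + x) * (m + y)))"
    unfolding cubic_sum_def sum_product w_def
    by (intro sum.cong refl) (simp add: chi_mult add.commute mult_ac)
  also have "\<dots> = (\<Sum>x\<in>Fp. \<Sum>y\<in>Fp. \<Sum>m\<in>Fp. w x * w y * chi ((m + x) * (m + y)))"
    by (subst sum.swap) (intro sum.cong refl sum.swap)
  also have "\<dots> = (\<Sum>x\<in>Fp. \<Sum>y\<in>Fp. (if x = y then p * (w x * w y) else 0) - w x * w y)"
  proof (intro sum.cong refl)
    fix x y assume xy: "x \<in> Fp" "y \<in> Fp"
    have "(\<Sum>m\<in>Fp. w x * w y * chi ((m + x) * (m + y))) = w x * w y * (if p dvd x - y then p - 1 else -1)"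
      by (simp only: sum_chi_quadratic flip: sum_distrib_left)
    moreover have "p dvd x - y \<longleftrightarrow> x = y" using residues_eqI[OF xy] by auto
    ultimately show "(\<Sum>m\<in>Fp. w x * w y * chi ((m + x) * (m + y)))
        = (if x = y then p * (w x * w y) else 0) - w x * w y"
      by (simp add: algebra_simps)
  qed
  also have "\<dots> = p * (\<Sum>x\<in>Fp. w x * w x) - (\<Sum>x\<in>Fp. w x) * (\<Sum>x\<in>Fp. w x)"
    by (simp add: sum_subtractf sum_product sum_distrib_left[where r = p])
  also have "\<dots> \<le> p * (\<Sum>x\<in>Fp. w x * w x)" by simp
  also have "(\<Sum>x\<in>Fp. w x * w x) \<le> (\<Sum>x\<in>Fp. 1)"
    unfolding w_def by (intro sum_mono) (simp only: chi_square_if, simp)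
  then have "p * (\<Sum>x\<in>Fp. w x * w x) \<le> p * p" using card_residues gt2 by simp
  finally show ?thesis by simp
qed

text \<open>Clearing the denominator costs a factor \<open>chi x\<close>, which is its own
  inverse.\<close>

lemma chi_inv_factor: "\<not> p dvd x \<Longrightarrow> chi (1 + B * inv_mod x) = chi x * chi (x + B)"
proof -
  assume x: "\<not> p dvd x"
  have "x * (1 + B * inv_mod x) - (x + B) = B * (x * inv_mod x - 1)"
    by (simp add: algebra_simps)
  then have "chi (x * (1 + B * inv_mod x)) = chi (x + B)"
    using inv_mod[OF x] by (intro chi_dvd_cong) simp
  then show ?thesis using chi_mult_self_left[OF x, of "chi (1 + B * inv_mod x)"] by (simp add: chi_mult)
qed

text \<open>The Moebius map sending \<open>-a, -b, -c\<close> to \<open>\<infinity>, 0, -1\<close> sends \<open>-d\<close> to \<open>-m\<close>, a cross ratio.\<close>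

lemma abs_quartic_sum_le_cubic:
  assumes B: "\<not> p dvd b - a" and C: "\<not> p dvd c - a" and D: "\<not> p dvd d - a" and BC: "\<not> p dvd b - c"
    and m: "p dvd m * ((b - c) * (d - a)) - (b - d) * (c - a)"
  shows "\<bar>quartic_sum a b c d\<bar> \<le> 1 + \<bar>cubic_sum m\<bar>"
proof -
  define B' C' D' where "B' = b - a" and "C' = c - a" and "D' = d - a"
  define h where "h w = chi ((1 + B' * w) * (1 + C' * w) * (1 + D' * w))" for w
  have per_h: "periodic h" unfolding h_def by (intro periodic_intros)
  have per: "periodic (\<lambda>x. chi (x * (x + B') * (x + C') * (x + D')))" by (intro periodic_intros)
  have "quartic_sum a b c d = (\<Sum>x\<in>Fp. chi (x * (x + B') * (x + C') * (x + D')))"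
    using sum_shift[OF per, of a] by (simp add: quartic_sum_def B'_def C'_def D'_def add.commute)
  also have "\<dots> = (\<Sum>x\<in>Fp - {0}. chi (x * (x + B') * (x + C') * (x + D')))"
    using chi_eq_0_iff[of 0] by (simp add: sum_remove_zero)
  also have "\<dots> = (\<Sum>x\<in>Fp - {0}. h (inv_mod x * 1))"
  proof (intro sum.cong refl)
    fix x assume "x \<in> Fp - {0}"
    then have x: "\<not> p dvd x" by (rule nonzero_residue)
    show "chi (x * (x + B') * (x + C') * (x + D')) = h (inv_mod x * 1)"
      unfolding h_def mult_1_right chi_mult chi_inv_factor[OF x]
      using chi_pm1[OF x] by auto
  qed
  \<comment> \<open>The substitution \<open>w = 1/x\<close> misses \<open>w = 0\<close>, where
    \<open>h\<close> is 1; this is the 1 in the bound.\<close>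
  also have "\<dots> = (\<Sum>w\<in>Fp. h w) - 1"
    using sum_nonzero_inv[OF per_h not_dvd_1] by (simp add: sum_nonzero h_def chi_1)
  finally have 1: "quartic_sum a b c d = (\<Sum>w\<in>Fp. h w) - 1" .
  define i where "i = inv_mod (B' * C')"
  have nz: "\<not> p dvd B'" "\<not> p dvd C'" "\<not> p dvd B' - C'" "\<not> p dvd B' * C'"
    using assms by (auto simp: B'_def C'_def dvd_mult_iff)
  have j: "p dvd B' * C' * i - 1" unfolding i_def using nz by (intro inv_mod)
  have e: "\<not> p dvd i * (B' - C')" unfolding i_def using nz inv_mod_nonzero by (simp add: dvd_mult_iff)
  define K where "K = chi B' * chi C' * chi D' * chi (B' - C') * chi (B' * C')"
  \<comment> \<open>Modulo \<open>p\<close> the affine map sends \<open>0, -1, -m\<close> to the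
    zeros \<open>-1/B', -1/C', -1/D'\<close> of the factors of \<open>h\<close>; \<open>K\<close>
    collects the constants.\<close>
  have "h (i * (B' - C') * z + (- i * C')) = K * chi (z * (z + 1) * (z + m))" for z
  proof -
    define w where "w = i * (B' - C') * z + (- i * C')"
    define y where "y = (B' - C') * z - C'"
    have "B' * C' * (1 + B' * w) - B' * (B' - C') * z = B' * y * (B' * C' * i - 1)"
      "B' * C' * (1 + C' * w) - C' * (B' - C') * (z + 1) = C' * y * (B' * C' * i - 1)"
      by (auto simp: w_def y_def algebra_simps)
    then have w1: "chi (B' * C' * (1 + B' * w)) = chi (B' * (B' - C') * z)"
      and w2: "chi (B' * C' * (1 + C' * w)) = chi (C' * (B' - C') * (z + 1))"
      using j by (auto intro!: chi_dvd_cong)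
    have "B' * C' * (1 + D' * w) - D' * (B' - C') * (z + m)
        = D' * y * (B' * C' * i - 1) - (m * ((b - c) * (d - a)) - (b - d) * (c - a))"
      by (auto simp: w_def y_def B'_def C'_def D'_def algebra_simps)
    then have w3: "chi (B' * C' * (1 + D' * w)) = chi (D' * (B' - C') * (z + m))"
      using dvd_diff[OF dvd_mult[OF j, of "D' * y"] m] by (intro chi_dvd_cong) simp
    \<comment> \<open>Each of the three factors is multiplied by \<open>B' * C'\<close>; the fourth
      \<open>chi (B' * C')\<close> in front makes the total correction 1.\<close>
    have "h w = chi (B' * C') * ((chi (B' * C' * (1 + B' * w)) * chi (B' * C' * (1 + C' * w)))
       * chi (B' * C' * (1 + D' * w)))"
      using chi_pm1[OF nz(4)]
      unfolding h_def chi_mult[of "B' * C'"] chi_mult[of "(1 + B' * w) * (1 + C' * w)"]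
        chi_mult[of "1 + B' * w"] by (elim disjE) simp_all
    also have "\<dots> = chi (B' * C') * ((chi (B' * (B' - C') * z) * chi (C' * (B' - C') * (z + 1)))
       * chi (D' * (B' - C') * (z + m)))"
      by (simp only: w1 w2 w3)
    also have "\<dots> = K * chi (z * (z + 1) * (z + m))"
      using chi_pm1[OF nz(3)] by (elim disjE) (simp_all add: K_def chi_mult)
    finally show ?thesis unfolding w_def .
  qed
  then have "(\<Sum>w\<in>Fp. h w) = K * cubic_sum m"
    using sum_affine[OF per_h e, of "- i * C'"] by (simp add: cubic_sum_def sum_distrib_left)
  moreover have "\<bar>K\<bar> \<le> 1"
    unfolding K_def abs_mult by (intro mult_le_one abs_chi_le mult_nonneg_nonneg abs_ge_zero)
  then have "\<bar>K * cubic_sum m\<bar> \<le> \<bar>cubic_sum m\<bar>"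
    by (simp add: abs_mult mult_left_le_one_le)
  ultimately show ?thesis using 1 by linarith
qed

lemma abs_quartic_sum_le: "\<bar>quartic_sum a b c d\<bar> \<le> p"
proof -
  have "\<bar>quartic_sum a b c d\<bar> \<le> (\<Sum>x\<in>Fp. \<bar>chi ((x + a) * (x + b) * (x + c) * (x + d))\<bar>)"
    unfolding quartic_sum_def by (rule sum_abs)
  also have "\<dots> \<le> (\<Sum>x\<in>Fp. 1)" by (intro sum_mono abs_chi_le)
  finally show ?thesis using card_residues by simp
qed

text \<open>The double factor contributes 1 except at \<open>x = -a\<close>. What is left is a
  quadratic sum with value -1, minus its term at that point.\<close>

lemma abs_quartic_sum_square_factor:
  assumes "\<not> p dvd c - d"
  shows "\<bar>quartic_sum a a c d\<bar> \<le> 2"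
proof -
  define C D where "C = c - a" and "D = d - a"
  have per: "periodic (\<lambda>x. chi (x * x * (x + C) * (x + D)))" by (intro periodic_intros)
  have "quartic_sum a a c d = (\<Sum>x\<in>Fp. chi (x * x * (x + C) * (x + D)))"
    using sum_shift[OF per, of a] by (simp add: quartic_sum_def C_def D_def add.commute)
  also have "\<dots> = (\<Sum>x\<in>Fp - {0}. chi (x * x * (x + C) * (x + D)))"
    using chi_eq_0_iff[of 0] by (simp add: sum_remove_zero)
  also have "\<dots> = (\<Sum>x\<in>Fp - {0}. chi ((x + C) * (x + D)))"
    using chi_square[OF nonzero_residue] by (intro sum.cong refl) (simp add: chi_mult)
  also have "\<dots> = - 1 - chi (C * D)"
    using assms by (simp add: sum_nonzero sum_chi_quadratic C_def D_def)
  finally show ?thesis using abs_chi_le[of "C * D"] by linarith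
qed

section \<open>Pointwise bounds for cubic and quartic sums\<close>

text \<open>With \<open>y = x/r\<close>, the factors of the second cubic become \<open>x\<close>,
  \<open>x + r\<close> and \<open>x + l * r\<close> up to three factors \<open>chi r\<close>, and
  \<open>x\<close> cancels against the \<open>x\<close> of the first. Each \<open>r\<close> leaves
  one quartic sum; the omitted term at \<open>x = 0\<close> accounts for the 1.\<close>

lemma cubic_sum_square_le:
  assumes l: "\<not> p dvd l"
  shows "cubic_sum l * cubic_sum l \<le> (\<Sum>r\<in>Fp - {0}. 1 + \<bar>quartic_sum 1 l r (l * r)\<bar>)"
proof -
  define f where "f x = chi (x * (x + 1) * (x + l))" for x
  have per: "periodic f" unfolding f_def by (intro periodic_intros)
  have S: "cubic_sum l = (\<Sum>x\<in>Fp - {0}. f x)"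
    using chi_eq_0_iff[of 0] by (simp add: cubic_sum_def f_def sum_remove_zero)
  have "cubic_sum l * cubic_sum l = (\<Sum>x\<in>Fp - {0}. \<Sum>y\<in>Fp - {0}. f x * f y)"
    unfolding S by (rule sum_product)
  also have "\<dots> = (\<Sum>x\<in>Fp - {0}. \<Sum>r\<in>Fp - {0}. f x * f (inv_mod r * x))"
    using sum_nonzero_inv[OF per nonzero_residue] by (simp flip: sum_distrib_left)
  also have "\<dots> = (\<Sum>r\<in>Fp - {0}. \<Sum>x\<in>Fp - {0}. f x * f (inv_mod r * x))"
    by (rule sum.swap)
  also have "\<dots> \<le> (\<Sum>r\<in>Fp - {0}. 1 + \<bar>quartic_sum 1 l r (l * r)\<bar>)"
  proof (rule sum_mono)
    fix r assume "r \<in> Fp - {0}"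
    then have r: "\<not> p dvd r" by (rule nonzero_residue)
    have fac: "chi (inv_mod r * x + B) = chi r * chi (x + B * r)" for x B
    proof -
      have "r * (inv_mod r * x + B) - (x + B * r) = (r * inv_mod r - 1) * x"
        by (simp add: algebra_simps)
      then have "chi (r * (inv_mod r * x + B)) = chi (x + B * r)"
        using inv_mod[OF r] by (intro chi_dvd_cong) simp
      then show ?thesis
        using chi_mult_self_left[OF r, of "chi (inv_mod r * x + B)"] by (simp add: chi_mult)
    qed
    have "(\<Sum>x\<in>Fp - {0}. f x * f (inv_mod r * x))
        = (\<Sum>x\<in>Fp - {0}. chi r * chi ((x + 1) * (x + l) * (x + r) * (x + l * r)))"
    proof (intro sum.cong refl)
      fix x assume "x \<in> Fp - {0}"
      then have x: "\<not> p dvd x" by (rule nonzero_residue)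
      show "f x * f (inv_mod r * x) = chi r * chi ((x + 1) * (x + l) * (x + r) * (x + l * r))"
        unfolding f_def chi_mult fac chi_inv_mod[OF r] mult_1_left
        using chi_pm1[OF r] chi_pm1[OF x] by auto
    qed
    also have "\<dots> = chi r * (quartic_sum 1 l r (l * r) - chi (l * r * (l * r)))"
      by (simp add: quartic_sum_def sum_nonzero flip: sum_distrib_left)
    also have "\<dots> \<le> \<bar>chi r\<bar> * \<bar>quartic_sum 1 l r (l * r) - chi (l * r * (l * r))\<bar>"
      by (metis abs_ge_self abs_mult)
    also have "\<dots> \<le> 1 * (\<bar>quartic_sum 1 l r (l * r)\<bar> + 1)"
      using abs_chi_le[of "l * r * (l * r)"] by (intro mult_mono abs_chi_le) auto
    finally show "(\<Sum>x\<in>Fp - {0}. f x * f (inv_mod r * x)) \<le> 1 + \<bar>quartic_sum 1 l r (l * r)\<bar>"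
      by simp
  qed
  finally show ?thesis .
qed

lemma inv_mod_solves: "\<not> p dvd e \<Longrightarrow> p dvd inv_mod e * f * e - f"
  using dvd_mult2[OF inv_mod, of e f] by (simp add: algebra_simps)

lemma card_Fp_minus_zero: "int (card (Fp - {0})) = p - 1"
  using gt2 by (simp add: of_nat_diff)

text \<open>At most three \<open>r\<close> are degenerate and get the trivial bound
  \<open>p\<close>. For the others the quartic sum is bounded by 1 plus a cubic sum at the cross
  ratio \<open>m r\<close>, and each cross ratio occurs for at most two \<open>r\<close>. Hence
  \<open>3 p + p\<close> and the factor 2.\<close>

lemma sum_abs_quartic_sum_le:
  assumes l: "\<not> p dvd l" and l1: "\<not> p dvd l - 1"
  shows "(\<Sum>r\<in>Fp - {0}. \<bar>quartic_sum 1 l r (l * r)\<bar>) \<le> 4 * p + 2 * (\<Sum>m\<in>Fp. \<bar>cubic_sum m\<bar>)"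
proof -
  \<comment> \<open>Exactly the \<open>r\<close> for which two of \<open>1, l, r, l * r\<close>
    agree modulo \<open>p\<close>, namely \<open>1\<close>, \<open>l\<close> and
    \<open>1/l\<close>.\<close>
  define bad where "bad = {r \<in> Fp - {0}. p dvd (r - 1) * ((l - r) * (l * r - 1))}"
  define good where "good = Fp - {0} - bad"
  \<comment> \<open>The cross ratio required by \<open>abs_quartic_sum_le_cubic\<close> for
    \<open>1, l, r, l * r\<close>, reduced so that it lies in \<open>Fp\<close>.\<close>
  define m where "m r = (inv_mod ((l - r) * (l * r - 1)) * ((l - l * r) * (r - 1))) mod p" for r
  have fin: "finite bad" "finite good"
    unfolding good_def bad_def by (rule finite_subset[of _ Fp], blast, simp)+
  have badle: "(\<Sum>r\<in>bad. \<bar>quartic_sum 1 l r (l * r)\<bar>) \<le> 3 * p"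
  proof -
    have "bad \<subseteq> {1, l mod p, inv_mod l mod p}"
    proof
      fix r assume r: "r \<in> bad"
      then have rF: "r \<in> Fp" by (simp add: bad_def)
      have resI: "r = y mod p" if "p dvd r - y" for y
        using that rF by (simp flip: mod_eq_dvd_iff)
      from r consider "p dvd r - 1" | "p dvd r - l" | "p dvd l * r - 1"
        by (auto simp: bad_def dvd_mult_iff dvd_diff_commute)
      then show "r \<in> {1, l mod p, inv_mod l mod p}"
      proof cases
        case 1
        then show ?thesis using residues_eqI[of r 1] rF gt2 by auto
      next
        case 2
        then show ?thesis using resI by auto
      next
        case 3
        have "r - inv_mod l = inv_mod l * (l * r - 1) - (l * inv_mod l - 1) * r"
          by (simp add: algebra_simps)
        then have "p dvd r - inv_mod l"
          using 3 inv_mod[OF l] by (metis dvd_diff dvd_mult dvd_mult2)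
        then show ?thesis using resI by auto
      qed
    qed
    then have "card bad \<le> card {1, l mod p, inv_mod l mod p}" by (intro card_mono) auto
    also have "\<dots> \<le> 3" by (simp add: card_insert_if)
    finally have "int (card bad) * p \<le> 3 * p" using gt2 by simp
    moreover have "(\<Sum>r\<in>bad. \<bar>quartic_sum 1 l r (l * r)\<bar>) \<le> (\<Sum>r\<in>bad. p)"
      by (intro sum_mono abs_quartic_sum_le)
    ultimately show ?thesis by simp
  qed
  have gooddvd: "\<not> p dvd r - 1" "\<not> p dvd l - r" "\<not> p dvd l * r - 1" "r \<in> Fp - {0}" if "r \<in> good" for r
    using that by (auto simp: good_def bad_def dvd_mult_iff)
  have mr: "p dvd m r * ((l - r) * (l * r - 1)) - (l - l * r) * (r - 1)" if r: "r \<in> good" for r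
  proof -
    let ?E = "(l - r) * (l * r - 1)" and ?F = "(l - l * r) * (r - 1)"
    have "\<not> p dvd ?E" using gooddvd[OF r] by (simp add: dvd_mult_iff)
    then have "p dvd inv_mod ?E * ?F * ?E - ?F" by (rule inv_mod_solves)
    moreover have "p dvd (m r - inv_mod ?E * ?F) * ?E"
      unfolding m_def by (intro dvd_mult2) (simp flip: mod_eq_dvd_iff)
    ultimately have "p dvd (m r - inv_mod ?E * ?F) * ?E + (inv_mod ?E * ?F * ?E - ?F)"
      by (intro dvd_add)
    then show ?thesis by (simp only: left_diff_distrib diff_add_cancel add_diff_eq)
  qed
  have fibre: "card {r \<in> good. m r = y} \<le> 2" for y
  proof (cases "{r \<in> good. m r = y} = {}")
    case False
    then obtain s where s: "s \<in> good" "m s = y" by auto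
    have "{r \<in> good. m r = y} \<subseteq> {s, inv_mod s mod p}"
    proof
      fix r assume "r \<in> {r \<in> good. m r = y}"
      then have r: "r \<in> good" "m r = y" by auto
      let ?G = "\<lambda>r. (l - r) * (l * r - 1)"
      let ?H = "\<lambda>r. (l - l * r) * (r - 1)"
      have "p dvd (m r * ?G r - ?H r) * ?G s - (m s * ?G s - ?H s) * ?G r"
        by (intro dvd_diff dvd_mult2 mr r s)
      also have "(m r * ?G r - ?H r) * ?G s - (m s * ?G s - ?H s) * ?G r = ?H s * ?G r - ?H r * ?G s"
        using r s by (simp add: algebra_simps)
      \<comment> \<open>This factorisation shows that \<open>r\<close> and \<open>s\<close> have
        equal cross ratios only if \<open>r = s\<close> or \<open>r = 1/s\<close>.\<close>
      also have "\<dots> = l * ((l - 1) * ((l - 1) * ((r - s) * (r * s - 1))))"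
        by (simp add: algebra_simps power2_eq_square power3_eq_cube)
      finally have "p dvd r - s \<or> p dvd r * s - 1" using l l1 by (simp add: dvd_mult_iff)
      then show "r \<in> {s, inv_mod s mod p}"
      proof
        assume "p dvd r - s"
        then have "r = s" using gooddvd(4) r s by (intro residues_eqI) auto
        then show ?thesis by simp
      next
        assume "p dvd r * s - 1"
        moreover have "r - inv_mod s = (r * s - 1) * inv_mod s - (s * inv_mod s - 1) * r"
          by (simp add: algebra_simps)
        ultimately have "p dvd r - inv_mod s"
          using inv_mod[OF nonzero_residue[OF gooddvd(4)[OF s(1)]]] by (metis dvd_diff dvd_mult2)
        then have "r = inv_mod s mod p"
          using gooddvd(4)[OF r(1)] by (simp flip: mod_eq_dvd_iff)
        then show ?thesis by simp
      qed
    qed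
    then have "card {r \<in> good. m r = y} \<le> card {s, inv_mod s mod p}" by (intro card_mono) auto
    also have "\<dots> \<le> 2" by (simp add: card_insert_if)
    finally show ?thesis .
  next
    case True
    then show ?thesis by (simp only: card.empty)
  qed
  have "(\<Sum>r\<in>good. \<bar>quartic_sum 1 l r (l * r)\<bar>) \<le> (\<Sum>r\<in>good. 1 + \<bar>cubic_sum (m r)\<bar>)"
    using gooddvd l1 mr
    by (intro sum_mono abs_quartic_sum_le_cubic) (auto simp: mult.commute)
  also have "\<dots> = int (card good) + (\<Sum>r\<in>good. \<bar>cubic_sum (m r)\<bar>)"
    by (simp add: sum.distrib)
  also have "(\<Sum>r\<in>good. \<bar>cubic_sum (m r)\<bar>) \<le> int 2 * (\<Sum>m\<in>Fp. \<bar>cubic_sum m\<bar>)"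
    using gt2 fin fibre by (intro sum_comp_le_card_fibres) (auto simp: m_def)
  also have "card good \<le> card Fp" by (intro card_mono) (auto simp: good_def)
  then have "int (card good) \<le> p" using card_residues by linarith
  finally have goodle: "(\<Sum>r\<in>good. \<bar>quartic_sum 1 l r (l * r)\<bar>) \<le> p + 2 * (\<Sum>m\<in>Fp. \<bar>cubic_sum m\<bar>)"
    by simp
  have "(\<Sum>r\<in>Fp - {0}. \<bar>quartic_sum 1 l r (l * r)\<bar>)
      = (\<Sum>r\<in>good. \<bar>quartic_sum 1 l r (l * r)\<bar>) + (\<Sum>r\<in>bad. \<bar>quartic_sum 1 l r (l * r)\<bar>)"
    unfolding good_def by (intro sum.subset_diff) (auto simp: bad_def)
  then show ?thesis using goodle badle by linarith
qed

text \<open>Cauchy-Schwarz over \<open>p\<close> terms and the second moment bound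
  \<open>p^2\<close> give \<open>p^3\<close> for the square.\<close>

lemma sum_abs_cubic_sum_le: "real_of_int (\<Sum>m\<in>Fp. \<bar>cubic_sum m\<bar>) \<le> real_of_int p powr (3/2)"
proof -
  have "(real_of_int (\<Sum>m\<in>Fp. \<bar>cubic_sum m\<bar>))\<^sup>2 = (\<Sum>m\<in>Fp. \<bar>real_of_int (cubic_sum m)\<bar>)\<^sup>2"
    by simp
  also have "\<dots> \<le> (\<Sum>m\<in>Fp. \<bar>real_of_int (cubic_sum m)\<bar>\<^sup>2) * card Fp"
    by (rule sum_squared_le_sum_of_squares)
  also have "(\<Sum>m\<in>Fp. \<bar>real_of_int (cubic_sum m)\<bar>\<^sup>2) = real_of_int (\<Sum>m\<in>Fp. cubic_sum m * cubic_sum m)"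
    by (simp add: power2_eq_square)
  also have "\<dots> * card Fp \<le> real_of_int (p * p) * card Fp"
    using sum_cubic_sum_squares by (intro mult_right_mono) (simp_all only: of_int_le_iff of_nat_0_le_iff)
  also have "\<dots> = (real_of_int p powr (3/2))\<^sup>2"
    using gt2 by (simp add: power2_eq_square powr_numeral power3_eq_cube flip: powr_add)
  finally show ?thesis by (rule power2_le_imp_le) simp
qed

text \<open>The square is at most \<open>5 p + 2 p powr (3/2)\<close>, hence at most
  \<open>9 p powr (3/2)\<close>.\<close>

lemma abs_cubic_sum_le:
  assumes l: "\<not> p dvd l" and l1: "\<not> p dvd l - 1"
  shows "real_of_int \<bar>cubic_sum l\<bar> \<le> 3 * real_of_int p powr (3/4)"
proof (rule power2_le_imp_le)
  have "cubic_sum l * cubic_sum l \<le> (p - 1) + (\<Sum>r\<in>Fp - {0}. \<bar>quartic_sum 1 l r (l * r)\<bar>)"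
    using cubic_sum_square_le[OF l] card_Fp_minus_zero by (simp add: sum.distrib)
  also have "\<dots> \<le> 5 * p + 2 * (\<Sum>m\<in>Fp. \<bar>cubic_sum m\<bar>)"
    using sum_abs_quartic_sum_le[OF assms] by linarith
  finally have "real_of_int (cubic_sum l * cubic_sum l) \<le> real_of_int (5 * p + 2 * (\<Sum>m\<in>Fp. \<bar>cubic_sum m\<bar>))"
    by (simp only: of_int_le_iff)
  also have "\<dots> \<le> 5 * real_of_int p + 2 * real_of_int p powr (3/2)"
    using sum_abs_cubic_sum_le by simp
  also have "\<dots> \<le> 5 * real_of_int p powr (3/2) + 2 * real_of_int p powr (3/2)"
    using powr_mono[of 1 "3/2" p] gt2 by simp
  finally have "real_of_int (cubic_sum l * cubic_sum l) \<le> 7 * real_of_int p powr (3/2)" by simp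
  moreover have "(real_of_int p powr (3/4))\<^sup>2 = real_of_int p powr (3/2)"
    by (simp add: power2_eq_square flip: powr_add)
  moreover have "7 * real_of_int p powr (3/2) \<le> 9 * real_of_int p powr (3/2)" by simp
  ultimately show "(real_of_int \<bar>cubic_sum l\<bar>)\<^sup>2 \<le> (3 * real_of_int p powr (3/4))\<^sup>2"
    by (simp only: power_mult_distrib power2_eq_square flip: of_int_mult)
qed simp

text \<open>The cross ratio of four distinct residues is neither 0 nor 1, so the cubic bound
  applies; the additional 1 is absorbed by raising the constant from 3 to 4.\<close>

lemma abs_quartic_sum_le_powr:
  assumes B: "\<not> p dvd b - a" and C: "\<not> p dvd c - a" and D: "\<not> p dvd d - a"
    and BC: "\<not> p dvd b - c" and BD: "\<not> p dvd b - d" and CD: "\<not> p dvd c - d"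
  shows "real_of_int \<bar>quartic_sum a b c d\<bar> \<le> 4 * real_of_int p powr (3/4)"
proof -
  define m where "m = inv_mod ((b - c) * (d - a)) * ((b - d) * (c - a))"
  have nz: "\<not> p dvd (b - c) * (d - a)" using assms by (simp add: dvd_mult_iff)
  have m: "p dvd m * ((b - c) * (d - a)) - (b - d) * (c - a)"
    unfolding m_def using nz by (rule inv_mod_solves)
  have m0: "\<not> p dvd m"
    unfolding m_def using inv_mod_nonzero[OF nz] assms by (simp add: dvd_mult_iff)
  have m1: "\<not> p dvd m - 1"
  proof
    assume "p dvd m - 1"
    \<comment> \<open>Eliminating \<open>m\<close> leaves the complementary product of differences,
      which is nonzero modulo \<open>p\<close>.\<close>
    then have "p dvd (m * ((b - c) * (d - a)) - (b - d) * (c - a)) - (m - 1) * ((b - c) * (d - a))"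
      using m dvd_diff dvd_mult2 by blast
    also have "\<dots> = (b - a) * (d - c)" by (simp add: algebra_simps)
    finally show False using B CD by (simp add: dvd_mult_iff dvd_diff_commute)
  qed
  have "real_of_int \<bar>quartic_sum a b c d\<bar> \<le> real_of_int (1 + \<bar>cubic_sum m\<bar>)"
    using abs_quartic_sum_le_cubic[OF B C D BC m] by (simp only: of_int_le_iff)
  moreover have "1 \<le> real_of_int p powr (3/4)" using gt2 by (intro ge_one_powr_ge_zero) auto
  ultimately show ?thesis using abs_cubic_sum_le[OF m0 m1] by simp
qed

section \<open>Solutions of quadratic congruences\<close>

text \<open>A solution makes \<open>D\<close> a square modulo \<open>p\<close>, so
  \<open>chi D\<close> is 0 or 1. Two solutions have values \<open>e * x - f\<close> that agree up
  to sign, so there are at most two, and only one if that value vanishes.\<close>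

lemma card_square_solutions_le:
  assumes e: "\<not> p dvd e"
  shows "int (card {x \<in> Fp. p dvd (e * x - f)\<^sup>2 - D}) \<le> 1 + chi D"
proof (cases "{x \<in> Fp. p dvd (e * x - f)\<^sup>2 - D} = {}")
  case True
  then show ?thesis using chi_cases[of D] by (simp only: card.empty) auto
next
  case False
  define Z where "Z = {x \<in> Fp. p dvd (e * x - f)\<^sup>2 - D}"
  obtain x0 where x0: "x0 \<in> Z" using False by (auto simp: Z_def)
  have chiD: "chi D = chi (e * x0 - f) * chi (e * x0 - f)"
    using x0 chi_dvd_cong[of "(e * x0 - f)\<^sup>2" D] by (simp add: Z_def power2_eq_square chi_mult)
  have or: "x = y \<or> p dvd (e * x - f) + (e * y - f)" if "x \<in> Z" "y \<in> Z" for x y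
  proof -
    have "p dvd ((e * x - f)\<^sup>2 - D) - ((e * y - f)\<^sup>2 - D)"
      using that by (intro dvd_diff[of p "(e * x - f)\<^sup>2 - D"]) (simp_all add: Z_def)
    also have "\<dots> = (e * (x - y)) * ((e * x - f) + (e * y - f))"
      by (simp add: algebra_simps power2_eq_square)
    finally show ?thesis using e that residues_eqI by (auto simp: dvd_mult_iff Z_def)
  qed
  have eq: "x = y" if "x \<in> Z" "y \<in> Z" "p dvd (e * x - f) + z" "p dvd (e * y - f) + z" for x y z
  proof -
    have "p dvd ((e * x - f) + z) - ((e * y - f) + z)" using that dvd_diff by blast
    then have "p dvd e * (x - y)" by (simp add: algebra_simps)
    then show ?thesis using e that residues_eqI by (auto simp: dvd_mult_iff Z_def)
  qed
  have "int (card Z) \<le> 1 + chi D"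
  proof (cases "p dvd e * x0 - f")
    case True
    have "Z \<subseteq> {x0}"
    proof
      fix x assume x: "x \<in> Z"
      show "x \<in> {x0}"
      proof (cases "x = x0")
        case False
        then have "p dvd (e * x - f) + (e * x0 - f)" using or[OF x x0] by simp
        moreover have "p dvd (e * x0 - f) + (e * x0 - f)" using True by (rule dvd_add) (rule True)
        ultimately show ?thesis using eq[OF x x0] by blast
      qed simp
    qed
    then have "card Z \<le> card {x0}" by (intro card_mono) auto
    then show ?thesis using chiD chi_cases[of "e * x0 - f"] by auto
  next
    case False
    then have 1: "chi D = 1" using chiD chi_square by simp
    show ?thesis
    proof (cases "Z \<subseteq> {x0}")
      case True
      then have "card Z \<le> card {x0}" by (intro card_mono) auto
      then show ?thesis using 1 by simp
    next
      case False
      then obtain x1 where x1: "x1 \<in> Z" "x1 \<noteq> x0" by auto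
      have "Z \<subseteq> {x0, x1}"
        using or[OF _ x0] eq[OF _ x1(1)] x1 by blast
      then have "card Z \<le> card {x0, x1}" by (intro card_mono) auto
      also have "\<dots> \<le> 2" by (simp add: card_insert_if)
      finally show ?thesis using 1 by simp
    qed
  qed
  then show ?thesis by (simp add: Z_def)
qed

subsection \<open>Choice of the shift\<close>

text \<open>Pairs are grouped by \<open>u + v\<close> because the part of the discriminant that
  involves the represented point depends on \<open>u\<close> and \<open>v\<close> only through this
  sum.\<close>

definition chi_convolution :: "nat \<Rightarrow> int \<Rightarrow> int \<Rightarrow> int" where
  "chi_convolution k t s = (\<Sum>(u, v)\<in>{1..int k} \<times> {1..int k}. if u + v = s then chi ((t + u) * (t + v)) else 0)"

text \<open>The weight \<open>g\<close> will be the convolution itself, for the second moment, and a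
  character value, for counting representations.\<close>

lemma sum_chi_convolution:
  "(\<Sum>s\<in>{2..2 * int k}. g s * chi_convolution k t s)
     = (\<Sum>(u, v)\<in>{1..int k} \<times> {1..int k}. g (u + v) * chi ((t + u) * (t + v)))"
proof -
  have "(\<Sum>s\<in>{2..2 * int k}. g s * chi_convolution k t s)
      = (\<Sum>s\<in>{2..2 * int k}. \<Sum>(u, v)\<in>{1..int k} \<times> {1..int k}. if u + v = s then g s * chi ((t + u) * (t + v)) else 0)"
    unfolding chi_convolution_def sum_distrib_left by (intro sum.cong refl) auto
  also have "\<dots> = (\<Sum>x\<in>{1..int k} \<times> {1..int k}. \<Sum>s\<in>{2..2 * int k}.
      if s = fst x + snd x then g (fst x + snd x) * chi ((t + fst x) * (t + snd x)) else 0)"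
    by (subst sum.swap) (intro sum.cong refl, auto)
  also have "\<dots> = (\<Sum>x\<in>{1..int k} \<times> {1..int k}. g (fst x + snd x) * chi ((t + fst x) * (t + snd x)))"
    by (intro sum.cong refl) (auto simp: sum.delta)
  finally show ?thesis by (simp add: case_prod_beta)
qed

text \<open>Expanding the square and summing over \<open>t\<close> innermost attaches a complete
  quartic sum to each additive quadruple in \<open>{1..int k}\<close>.\<close>

lemma sum_chi_convolution_squares:
  "(\<Sum>t\<in>Fp. \<Sum>s\<in>{2..2 * int k}. (chi_convolution k t s)\<^sup>2)
     = (\<Sum>(u, v)\<in>{1..int k} \<times> {1..int k}. \<Sum>(u', v')\<in>{1..int k} \<times> {1..int k}.
          if u + v = u' + v' then quartic_sum u v u' v' else 0)" (is "_ = ?R")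
proof -
  let ?P = "{1..int k} \<times> {1..int k}"
  have "(\<Sum>t\<in>Fp. \<Sum>s\<in>{2..2 * int k}. (chi_convolution k t s)\<^sup>2)
      = (\<Sum>t\<in>Fp. \<Sum>(u, v)\<in>?P. chi_convolution k t (u + v) * chi ((t + u) * (t + v)))"
    by (simp add: power2_eq_square sum_chi_convolution)
  also have "\<dots> = (\<Sum>t\<in>Fp. \<Sum>(u, v)\<in>?P. \<Sum>(u', v')\<in>?P.
      if u + v = u' + v' then chi ((t + u) * (t + v) * (t + u') * (t + v')) else 0)"
    unfolding chi_convolution_def sum_distrib_right
    by (intro sum.cong refl) (auto simp: sum_distrib_right chi_mult intro!: sum.cong)
  also have "\<dots> = (\<Sum>x\<in>?P. \<Sum>t\<in>Fp. \<Sum>y\<in>?P.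
      if fst x + snd x = fst y + snd y then chi ((t + fst x) * (t + snd x) * (t + fst y) * (t + snd y)) else 0)"
    unfolding case_prod_beta by (rule sum.swap)
  also have "\<dots> = (\<Sum>x\<in>?P. \<Sum>y\<in>?P. \<Sum>t\<in>Fp.
      if fst x + snd x = fst y + snd y then chi ((t + fst x) * (t + snd x) * (t + fst y) * (t + snd y)) else 0)"
    by (intro sum.cong refl sum.swap)
  also have "\<dots> = ?R"
    unfolding case_prod_beta by (intro sum.cong refl) (simp add: quartic_sum_def)
  finally show ?thesis .
qed

lemma quartic_sum_swap_pairs: "quartic_sum c d a b = quartic_sum a b c d"
  unfolding quartic_sum_def by (simp add: mult_ac)

lemma small_not_dvd:
  assumes "p > 2 * int k" "a \<in> {1..int k}" "b \<in> {1..int k}" "a \<noteq> b"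
  shows "\<not> p dvd a - b"
proof
  assume "p dvd a - b"
  then have "\<bar>p\<bar> \<le> \<bar>a - b\<bar>" using assms by (intro dvd_imp_le_int) auto
  then show False using assms by auto
qed

text \<open>Equal sums and \<open>off\<close> make \<open>a, b\<close> both different from
  \<open>c, d\<close>. Then either all four are distinct, or exactly one of the two pairs is a
  double root and the sum is at most 2.\<close>

lemma abs_quartic_sum_off_diagonal:
  assumes k: "p > 2 * int k"
    and I: "a \<in> {1..int k}" "b \<in> {1..int k}" "c \<in> {1..int k}" "d \<in> {1..int k}"
    and s: "a + b = c + d" and off: "(c, d) \<noteq> (a, b)" "(c, d) \<noteq> (b, a)"
  shows "real_of_int \<bar>quartic_sum a b c d\<bar> \<le> 4 * real_of_int p powr (3/4)"
proof -
  have 1: "1 \<le> real_of_int p powr (3/4)" using gt2 by (intro ge_one_powr_ge_zero) auto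
  have ne: "a \<noteq> c" "a \<noteq> d" "b \<noteq> c" "b \<noteq> d" using s off by auto
  note nd = small_not_dvd[OF k]
  consider "a = b" | "c = d" | "a \<noteq> b" "c \<noteq> d" by blast
  then show ?thesis
  proof cases
    case 1
    then have "\<bar>quartic_sum a b c d\<bar> \<le> 2"
      using abs_quartic_sum_square_factor[of c d a] nd[of c d] I ne s by auto
    then show ?thesis using \<open>1 \<le> real_of_int p powr (3/4)\<close> by linarith
  next
    case 2
    then have "\<bar>quartic_sum c d a b\<bar> \<le> 2"
      using abs_quartic_sum_square_factor[of a b c] nd[of a b] I ne s by auto
    then show ?thesis using 1 unfolding quartic_sum_swap_pairs[of c d] by linarith
  next
    case 3
    then show ?thesis using I ne by (intro abs_quartic_sum_le_powr nd) auto
  qed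
qed

text \<open>Each of the \<open>k^2\<close> pairs is matched with itself and its transpose; these
  coincide for the \<open>k\<close> pairs with equal entries.\<close>

lemma card_diagonal_pairs:
  "(\<Sum>x\<in>{1..int k} \<times> {1..int k}. \<Sum>y\<in>{1..int k} \<times> {1..int k}. if y = x \<or> y = (snd x, fst x) then 1 else 0 :: real)
     = 2 * real k ^ 2 - real k"
proof -
  let ?I = "{1..int k}"
  have "(\<Sum>y\<in>?I \<times> ?I. if y = x \<or> y = (snd x, fst x) then 1 else 0 :: real) = 2 - (if fst x = snd x then 1 else 0)"
    if x: "x \<in> ?I \<times> ?I" for x
  proof -
    have "(\<Sum>y\<in>?I \<times> ?I. if y = x \<or> y = (snd x, fst x) then 1 else 0 :: real)
        = real (card ((?I \<times> ?I) \<inter> {y. y = x \<or> y = (snd x, fst x)}))"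
      by (subst sum.If_cases) auto
    also have "(?I \<times> ?I) \<inter> {y. y = x \<or> y = (snd x, fst x)} = {x, (snd x, fst x)}"
      using x by auto
    also have "real (card {x, (snd x, fst x)}) = 2 - (if fst x = snd x then 1 else 0)"
      by (cases x) (auto simp: card_insert_if)
    finally show ?thesis .
  qed
  then have "(\<Sum>x\<in>?I \<times> ?I. \<Sum>y\<in>?I \<times> ?I. if y = x \<or> y = (snd x, fst x) then 1 else 0 :: real)
      = (\<Sum>x\<in>?I \<times> ?I. 2 - (if fst x = snd x then 1 else 0))"
    by (rule sum.cong[OF refl])
  also have "\<dots> = (\<Sum>u\<in>?I. \<Sum>v\<in>?I. 2 - (if u = v then 1 else 0))"
    by (simp add: sum.cartesian_product case_prod_beta)
  also have "\<dots> = (\<Sum>u\<in>?I. 2 * real k - 1)"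
    by (intro sum.cong refl) (simp add: sum_subtractf)
  finally show ?thesis by (simp add: algebra_simps power2_eq_square)
qed

text \<open>For these \<open>t\<close> some parabola parameter, or some sum of two, may vanish
  modulo \<open>p\<close>. Each of the \<open>k + (2 k - 1)\<close> linear congruences excludes at
  most one \<open>t\<close>.\<close>

lemma card_degenerate_shifts:
  assumes k: "k > 0"
  shows "card {t \<in> Fp. (\<exists>u\<in>{1..int k}. p dvd t + u) \<or> (\<exists>s\<in>{2..2 * int k}. p dvd 2 * t + s)} \<le> 3 * k"
proof -
  have two: "\<not> p dvd 2" using gt2 by (simp add: zdvd_not_zless)
  have le1: "card {t \<in> Fp. p dvd c * t + u} \<le> 1" if c: "\<not> p dvd c" for c u
  proof -
    have "t = t'" if t: "t \<in> Fp" "t' \<in> Fp" "p dvd c * t + u" "p dvd c * t' + u" for t t'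
    proof -
      have "p dvd (c * t + u) - (c * t' + u)" using t dvd_diff by blast
      then have "p dvd c * (t - t')" by (simp add: algebra_simps)
      then show ?thesis using c t residues_eqI by (auto simp: dvd_mult_iff)
    qed
    moreover have "finite {t \<in> Fp. p dvd c * t + u}" by (rule finite_subset[of _ Fp]) auto
    ultimately show ?thesis by (simp add: card_le_Suc0_iff_eq)
  qed
  have le: "card (\<Union>u\<in>B. {t \<in> Fp. p dvd c * t + u}) \<le> card B" if "finite B" "\<not> p dvd c" for B c
  proof -
    have "card (\<Union>u\<in>B. {t \<in> Fp. p dvd c * t + u}) \<le> (\<Sum>u\<in>B. card {t \<in> Fp. p dvd c * t + u})"
      using that by (intro card_UN_le)
    also have "\<dots> \<le> (\<Sum>u\<in>B. 1)" using le1 that by (intro sum_mono)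
    finally show ?thesis by simp
  qed
  have "{t \<in> Fp. (\<exists>u\<in>{1..int k}. p dvd t + u) \<or> (\<exists>s\<in>{2..2 * int k}. p dvd 2 * t + s)}
      = (\<Union>u\<in>{1..int k}. {t \<in> Fp. p dvd 1 * t + u}) \<union> (\<Union>s\<in>{2..2 * int k}. {t \<in> Fp. p dvd 2 * t + s})"
    by auto
  also have "card \<dots> \<le> card {1..int k} + card {2..2 * int k}"
    using le[of "{1..int k}" 1] le[of "{2..2 * int k}" 2] two not_dvd_1
    by (intro order_trans[OF card_Un_le] add_mono) auto
  also have "\<dots> \<le> 3 * k" by simp
  finally show ?thesis .
qed

text \<open>Averaging over \<open>t\<close>: if all nondegenerate shifts failed, the second moment
  would be at least \<open>(p - 3 k) (N + 1)\<close>, whereas it is at most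
  \<open>p N + k^4 C\<close>. Together these contradict \<open>large\<close>.\<close>

lemma exists_good_shift:
  assumes k: "k > 0" and p2k: "p > 2 * int k"
    and large: "real_of_int p > 3 * real k * (2 * real k ^ 2 - real k + 1) + 4 * real k ^ 4 * real_of_int p powr (3/4)"
  shows "\<exists>t\<in>Fp. (\<forall>u\<in>{1..int k}. \<not> p dvd t + u) \<and> (\<forall>s\<in>{2..2 * int k}. \<not> p dvd 2 * t + s) \<and>
    (\<Sum>s\<in>{2..2 * int k}. (chi_convolution k t s)\<^sup>2) \<le> 2 * int k ^ 2 - int k"
proof (rule ccontr)
  assume contra: "\<not> ?thesis"
  let ?P = "{1..int k} \<times> {1..int k}"
  define V where "V t = (\<Sum>s\<in>{2..2 * int k}. (chi_convolution k t s)\<^sup>2)" for t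
  define N where "N = 2 * int k ^ 2 - int k"
  define C where "C = 4 * real_of_int p powr (3/4)"
  define bad where "bad = {t \<in> Fp. (\<exists>u\<in>{1..int k}. p dvd t + u) \<or> (\<exists>s\<in>{2..2 * int k}. p dvd 2 * t + s)}"
  \<comment> \<open>\<open>V t\<close> is an integer, so exceeding \<open>N\<close> means a gap of
    at least 1; summed over \<open>t\<close>, this gap supplies the leading term
    \<open>p\<close>.\<close>
  have VN: "N + 1 \<le> V t" if "t \<in> Fp - bad" for t
  proof (rule ccontr)
    assume "\<not> N + 1 \<le> V t"
    then have "V t \<le> N" by simp
    then show False using contra that unfolding V_def N_def bad_def by blast
  qed
  have "int k * 1 \<le> int k * int k" using k by (intro mult_left_mono) auto
  then have N0: "0 \<le> N + 1" by (simp add: N_def power2_eq_square)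
  have bad: "bad \<subseteq> Fp" "int (card bad) \<le> 3 * int k"
    using card_degenerate_shifts[OF k] unfolding bad_def by (blast, linarith)
  have fin: "finite bad" using bad(1) by (rule finite_subset) simp
  have "card (Fp - bad) = card Fp - card bad" using bad(1) fin by (rule card_Diff_subset[rotated])
  then have "p - 3 * int k \<le> int (card (Fp - bad))" using bad(2) card_residues by linarith
  then have "(p - 3 * int k) * (N + 1) \<le> int (card (Fp - bad)) * (N + 1)"
    using N0 by (rule mult_right_mono)
  also have "\<dots> = (\<Sum>t\<in>Fp - bad. N + 1)" by simp
  also have "\<dots> \<le> (\<Sum>t\<in>Fp - bad. V t)" by (intro sum_mono VN)
  also have "\<dots> \<le> (\<Sum>t\<in>Fp. V t)"
    by (intro sum_mono2) (auto simp: V_def intro!: sum_nonneg)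
  also have "\<dots> = (\<Sum>x\<in>?P. \<Sum>y\<in>?P.
      if fst x + snd x = fst y + snd y then quartic_sum (fst x) (snd x) (fst y) (snd y) else 0)"
    unfolding V_def sum_chi_convolution_squares case_prod_beta ..
  finally have "real_of_int ((p - 3 * int k) * (N + 1)) \<le> real_of_int (\<Sum>x\<in>?P. \<Sum>y\<in>?P.
      if fst x + snd x = fst y + snd y then quartic_sum (fst x) (snd x) (fst y) (snd y) else 0)"
    by (simp only: of_int_le_iff)
  also have "\<dots> = (\<Sum>x\<in>?P. \<Sum>y\<in>?P. real_of_int
      (if fst x + snd x = fst y + snd y then quartic_sum (fst x) (snd x) (fst y) (snd y) else 0))"
    by simp
  \<comment> \<open>Diagonal quadruples get the trivial bound \<open>p\<close>, and \<open>C\<close>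
    is charged to all \<open>k^4\<close> quadruples.\<close>
  also have "\<dots> \<le> (\<Sum>x\<in>?P. \<Sum>y\<in>?P. real_of_int p * (if y = x \<or> y = (snd x, fst x) then 1 else 0) + C)"
  proof (intro sum_mono)
    fix x y assume xy: "x \<in> ?P" "y \<in> ?P"
    obtain a b where x: "x = (a, b)" by (cases x)
    obtain c d where y: "y = (c, d)" by (cases y)
    have C0: "0 \<le> C" by (simp add: C_def)
    show "real_of_int (if fst x + snd x = fst y + snd y then quartic_sum (fst x) (snd x) (fst y) (snd y) else 0)
      \<le> real_of_int p * (if y = x \<or> y = (snd x, fst x) then 1 else 0) + C"
    proof (cases "a + b = c + d")
      case True
      show ?thesis
      proof (cases "y = x \<or> y = (snd x, fst x)")
        case True
        have "real_of_int (quartic_sum a b c d) \<le> real_of_int p"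
          using abs_quartic_sum_le[of a b c d] by linarith
        then show ?thesis using True C0 \<open>a + b = c + d\<close> by (simp add: x y)
      next
        case False
        then have "real_of_int \<bar>quartic_sum a b c d\<bar> \<le> C"
          unfolding C_def using True xy by (intro abs_quartic_sum_off_diagonal[OF p2k]) (auto simp: x y)
        then show ?thesis using False by (auto simp: x y)
      qed
    next
      case False
      then show ?thesis using C0 gt2 by (simp add: x y)
    qed
  qed
  also have "\<dots> = p * (2 * real k ^ 2 - real k) + real k ^ 4 * C"
    using card_diagonal_pairs[of k]
    by (simp add: sum.distrib power4_eq_xxxx mult.assoc flip: sum_distrib_left)
  finally have "real_of_int p \<le> 3 * real k * (2 * real k ^ 2 - real k + 1) + real k ^ 4 * C"
    by (simp add: N_def algebra_simps)
  then show False using large by (simp add: C_def mult_ac)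
qed

text \<open>Cauchy-Schwarz over the \<open>2 k - 1\<close> values of \<open>s\<close>: as
  \<open>2 k^2 - k = k (2 k - 1)\<close>, the square is at most \<open>k (2 k - 1)^2\<close>, which
  is at most \<open>4 k^3\<close>.\<close>

lemma sum_abs_chi_convolution_le:
  assumes k: "k > 0" and V: "(\<Sum>s\<in>{2..2 * int k}. (chi_convolution k t s)\<^sup>2) \<le> 2 * int k ^ 2 - int k"
  shows "real_of_int (\<Sum>s\<in>{2..2 * int k}. \<bar>chi_convolution k t s\<bar>) \<le> 2 * real k powr (3/2)"
proof (rule power2_le_imp_le)
  have "(real_of_int (\<Sum>s\<in>{2..2 * int k}. \<bar>chi_convolution k t s\<bar>))\<^sup>2
      = (\<Sum>s\<in>{2..2 * int k}. \<bar>real_of_int (chi_convolution k t s)\<bar>)\<^sup>2"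
    by simp
  also have "\<dots> \<le> (\<Sum>s\<in>{2..2 * int k}. \<bar>real_of_int (chi_convolution k t s)\<bar>\<^sup>2) * card {2..2 * int k}"
    by (rule sum_squared_le_sum_of_squares)
  also have "(\<Sum>s\<in>{2..2 * int k}. \<bar>real_of_int (chi_convolution k t s)\<bar>\<^sup>2)
      = real_of_int (\<Sum>s\<in>{2..2 * int k}. (chi_convolution k t s)\<^sup>2)"
    by simp
  also have "\<dots> * card {2..2 * int k} \<le> real_of_int (2 * int k ^ 2 - int k) * card {2..2 * int k}"
    using V by (intro mult_right_mono) (simp_all only: of_int_le_iff of_nat_0_le_iff)
  also have "real (card {2..2 * int k}) = 2 * real k - 1" using k by (simp add: of_nat_diff)
  also have "real_of_int (2 * int k ^ 2 - int k) * (2 * real k - 1) = real k * (2 * real k - 1)\<^sup>2"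
    by (simp add: algebra_simps power2_eq_square)
  also have "\<dots> \<le> real k * (2 * real k)\<^sup>2"
    using k by (intro mult_left_mono power_mono) auto
  also have "\<dots> = (2 * real k powr (3/2))\<^sup>2"
    using k by (simp add: power2_eq_square powr_numeral power3_eq_cube flip: powr_add)
  finally show "(real_of_int (\<Sum>s\<in>{2..2 * int k}. \<bar>chi_convolution k t s\<bar>))\<^sup>2 \<le> (2 * real k powr (3/2))\<^sup>2" .
qed simp

subsection \<open>The union of parabolas\<close>

definition parabolas :: "nat \<Rightarrow> int \<Rightarrow> (int \<times> int) set" where
  "parabolas k t = {(x, y). x \<in> Fp \<and> y \<in> Fp \<and> (\<exists>u\<in>{1..int k}. p dvd (t + u) * y - x * x)}"

text \<open>The ordinate over \<open>x\<close> on the parabola \<open>c y = x^2\<close>, for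
  \<open>c\<close> invertible modulo \<open>p\<close>.\<close>

definition parabola_point :: "int \<Rightarrow> int \<Rightarrow> int" where
  "parabola_point c x = inv_mod c * (x * x) mod p"

lemma parabola_point_in: "parabola_point c x \<in> Fp"
  using gt2 by (simp add: parabola_point_def)

lemma parabola_point_dvd:
  assumes "\<not> p dvd c"
  shows "p dvd c * parabola_point c x - x * x"
proof -
  have "p dvd c * (parabola_point c x - inv_mod c * (x * x))"
    unfolding parabola_point_def by (intro dvd_mult) (simp flip: mod_eq_dvd_iff)
  then have "p dvd c * (parabola_point c x - inv_mod c * (x * x)) + (inv_mod c * (x * x) * c - x * x)"
    using inv_mod_solves[OF assms] by (rule dvd_add)
  then show ?thesis by (simp add: algebra_simps)
qed

lemma parabola_point_unique:
  assumes c: "\<not> p dvd c" and y: "y \<in> Fp" "p dvd c * y - x * x"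
  shows "y = parabola_point c x"
proof -
  have "p dvd (c * y - x * x) - (c * parabola_point c x - x * x)"
    using y parabola_point_dvd[OF c] by (intro dvd_diff[of p "c * y - x * x"])
  then have "p dvd c * (y - parabola_point c x)" by (simp add: algebra_simps)
  then show ?thesis using c y parabola_point_in by (auto simp: dvd_mult_iff intro: residues_eqI)
qed

text \<open>The parabolas meet only in the origin: for \<open>x\<close> nonzero also
  \<open>y\<close> is nonzero, and then \<open>y\<close> and \<open>x\<close> determine the
  parameter. This gives \<open>k (p - 1)\<close> points and the origin.\<close>

lemma card_parabolas:
  assumes p2k: "p > 2 * int k" and k: "k > 0" and t: "\<forall>u\<in>{1..int k}. \<not> p dvd t + u"
  shows "card (parabolas k t) = k * nat p - k + 1"
proof -
  define h where "h = (\<lambda>(x, u). (x, parabola_point (t + u) x))"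
  let ?B = "(Fp - {0}) \<times> {1..int k}"
  have "parabolas k t = insert (0, 0) (h ` ?B)"
  proof (intro equalityI subsetI)
    fix z assume z: "z \<in> parabolas k t"
    then obtain x y u where xy: "z = (x, y)" "x \<in> Fp" "y \<in> Fp" "u \<in> {1..int k}"
      "p dvd (t + u) * y - x * x" by (auto simp: parabolas_def)
    show "z \<in> insert (0, 0) (h ` ?B)"
    proof (cases "x = 0")
      case True
      then have "y = 0" using xy t residues_dvd_iff by (auto simp: dvd_mult_iff)
      then show ?thesis using True xy by simp
    next
      case False
      have "y = parabola_point (t + u) x" using xy t by (intro parabola_point_unique) auto
      then have "z = h (x, u)" using xy by (simp add: h_def)
      then show ?thesis using xy False by blast
    qed
  next
    fix z assume "z \<in> insert (0, 0) (h ` ?B)"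
    then consider "z = (0, 0)" | w where "w \<in> ?B" "z = h w" by blast
    then show "z \<in> parabolas k t"
    proof cases
      case 1
      then show ?thesis using gt2 k by (auto simp: parabolas_def intro!: bexI[of _ 1])
    next
      case 2
      obtain x u where "w = (x, u)" by (cases w)
      then have "x \<in> Fp" "u \<in> {1..int k}" "z = (x, parabola_point (t + u) x)"
        using 2 by (auto simp: h_def)
      then show ?thesis
        using parabola_point_in parabola_point_dvd[of "t + u" x] t by (auto simp: parabolas_def)
    qed
  qed
  moreover have "(0, 0) \<notin> h ` ?B" by (auto simp: h_def)
  moreover have "inj_on h ?B"
  proof (rule inj_onI)
    fix z z' assume z: "z \<in> ?B" "z' \<in> ?B" "h z = h z'"
    obtain x u where xu: "z = (x, u)" by (cases z)
    obtain x' v where xv: "z' = (x', v)" by (cases z')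
    define y where "y = parabola_point (t + u) x"
    have e: "x' = x" "y = parabola_point (t + v) x" using z by (auto simp: h_def xu xv y_def)
    have nd: "\<not> p dvd t + u" "\<not> p dvd t + v" using z t by (auto simp: xu xv)
    have d: "p dvd (t + u) * y - x * x" "p dvd (t + v) * y - x * x"
      using parabola_point_dvd[OF nd(1), of x] parabola_point_dvd[OF nd(2), of x] e y_def by simp_all
    have x: "\<not> p dvd x" using z nonzero_residue by (auto simp: xu)
    have "\<not> p dvd y"
    proof
      assume "p dvd y"
      then have "p dvd (t + u) * y - ((t + u) * y - x * x)" using d(1) dvd_diff dvd_mult by blast
      then show False using x by (simp add: dvd_mult_iff)
    qed
    moreover have "p dvd ((t + u) * y - x * x) - ((t + v) * y - x * x)" using d by (rule dvd_diff)
    then have "p dvd (u - v) * y" by (simp add: algebra_simps)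
    ultimately have "p dvd u - v" by (simp add: dvd_mult_iff)
    then have "u = v" using small_not_dvd[OF p2k, of u v] z by (auto simp: xu xv)
    then show "z = z'" using e by (simp add: xu xv)
  qed
  ultimately have "card (parabolas k t) = Suc (card ?B)"
    by (simp add: card_image)
  also have "card ?B = (nat p - 1) * k"
    using gt2 by (simp add: card_cartesian_product nat_diff_distrib)
  finally show ?thesis by (simp add: algebra_simps)
qed

section \<open>Counting representations\<close>

lemma carrier_Zp_squared: "carrier (Zp_squared (nat p)) = Fp \<times> Fp"
  using gt2 by (simp add: Zp_squared_def carrier_integer_mod_group)

lemma mult_Zp_squared:
  "monoid.mult (Zp_squared (nat p)) (x, y) (x', y') = ((x + x') mod p, (y + y') mod p)"
  using gt2 by (simp add: Zp_squared_def)

text \<open>The quadratic equation for the abscissa \<open>x\<close> of the first summand, after completing the square.\<close>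

lemma parabola_sum_discriminant:
  assumes "p dvd c * y - x * x" "p dvd d * y' - x' * x'"
    and a: "a = (x + x') mod p" and b: "b = (y + y') mod p"
  shows "p dvd ((c + d) * x - c * a)\<^sup>2 - c * d * ((c + d) * b - a\<^sup>2)"
proof -
  have ab: "[a = x + x'] (mod p)" "[b = y + y'] (mod p)" by (simp_all add: a b cong_def)
  \<comment> \<open>Inserting the ordinates \<open>x^2/c\<close> and \<open>(a - x)^2/d\<close> in
    \<open>y + y' = b\<close> gives a quadratic in \<open>x\<close>; multiplying it by
    \<open>c + d\<close> completes the square. The identity records this as a combination of the two
    parabola equations.\<close>
  have "((c + d) * x - c * (x + x'))\<^sup>2 - c * d * ((c + d) * (y + y') - (x + x')\<^sup>2)
      = - ((c + d) * (d * (c * y - x * x) + c * (d * y' - x' * x')))"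
    by (simp add: algebra_simps power2_eq_square)
  moreover have "p dvd \<dots>" using assms by (simp add: dvd_add dvd_mult)
  moreover have "[((c + d) * x - c * a)\<^sup>2 - c * d * ((c + d) * b - a\<^sup>2)
      = ((c + d) * x - c * (x + x'))\<^sup>2 - c * d * ((c + d) * (y + y') - (x + x')\<^sup>2)] (mod p)"
    using ab by (intro cong_diff cong_mult cong_pow cong_refl)
  ultimately show ?thesis using cong_dvd_iff by metis
qed

text \<open>A representation is determined by its parameters \<open>u, v\<close> and its first
  abscissa, a root of a quadratic. The root counts add up to \<open>k^2\<close> plus a character
  sum; grouped by \<open>s = u + v\<close>, it has coefficients of absolute value at most 1 on the
  convolutions.\<close>

lemma card_rep_pairs_parabolas_le:
  assumes t: "\<forall>u\<in>{1..int k}. \<not> p dvd t + u" "\<forall>s\<in>{2..2 * int k}. \<not> p dvd 2 * t + s"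
    and ab: "a \<in> Fp" "b \<in> Fp"
  shows "int (card (rep_pairs (Zp_squared (nat p)) (parabolas k t) (a, b)))
    \<le> int k ^ 2 + (\<Sum>s\<in>{2..2 * int k}. \<bar>chi_convolution k t s\<bar>)"
proof -
  let ?P = "{1..int k} \<times> {1..int k}"
  define Z where "Z = (\<lambda>(u, v). {x \<in> Fp. p dvd ((2 * t + (u + v)) * x - (t + u) * a)\<^sup>2
      - (t + u) * (t + v) * ((2 * t + (u + v)) * b - a\<^sup>2)})"
  define r where "r = (\<lambda>((u, v), x). ((x, parabola_point (t + u) x),
      ((a - x) mod p, parabola_point (t + v) ((a - x) mod p))))"
  have finZ: "finite (Z w)" for w
    by (rule finite_subset[of _ Fp]) (auto simp: Z_def)
  \<comment> \<open>An inclusion is enough: a representation that uses the origin may come from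
    several pairs \<open>(u, v)\<close>.\<close>
  have "rep_pairs (Zp_squared (nat p)) (parabolas k t) (a, b) \<subseteq> r ` Sigma ?P Z"
  proof
    fix z assume "z \<in> rep_pairs (Zp_squared (nat p)) (parabolas k t) (a, b)"
    then obtain x y x' y' u v where z: "z = ((x, y), (x', y'))"
      and F: "x \<in> Fp" "y \<in> Fp" "x' \<in> Fp" "y' \<in> Fp" and uv: "u \<in> {1..int k}" "v \<in> {1..int k}"
      and d: "p dvd (t + u) * y - x * x" "p dvd (t + v) * y' - x' * x'"
      and s: "(x + x') mod p = a" "(y + y') mod p = b"
      by (auto simp: rep_pairs_def parabolas_def mult_Zp_squared)
    have "x' = (a - x) mod p"
      using F s by (metis add_diff_cancel_left' atLeastLessThan_iff mod_diff_left_eq mod_pos_pos_trivial)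
    moreover have "y = parabola_point (t + u) x" "y' = parabola_point (t + v) x'"
      using F d uv t by (auto intro!: parabola_point_unique)
    moreover have "2 * t + (u + v) = (t + u) + (t + v)" by simp
    then have "x \<in> Z (u, v)"
      using parabola_sum_discriminant[OF d s[symmetric]] F unfolding Z_def by simp
    ultimately show "z \<in> r ` Sigma ?P Z" using uv z
      by (intro image_eqI[of _ _ "((u, v), x)"]) (auto simp: r_def)
  qed
  then have "card (rep_pairs (Zp_squared (nat p)) (parabolas k t) (a, b)) \<le> card (Sigma ?P Z)"
    using finZ by (intro surj_card_le) auto
  also have "\<dots> = (\<Sum>w\<in>?P. card (Z w))" using finZ by simp
  finally have "int (card (rep_pairs (Zp_squared (nat p)) (parabolas k t) (a, b))) \<le> (\<Sum>w\<in>?P. int (card (Z w)))"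
    by (metis of_nat_le_iff of_nat_sum)
  \<comment> \<open>The leading coefficient \<open>2 * t + (u + v)\<close> is nonzero modulo
    \<open>p\<close> by the second condition on \<open>t\<close>.\<close>
  also have "\<dots> \<le> (\<Sum>(u, v)\<in>?P. 1 + chi ((t + u) * (t + v) * ((2 * t + (u + v)) * b - a\<^sup>2)))"
    unfolding Z_def case_prod_beta by (intro sum_mono card_square_solutions_le) (use t in auto)
  also have "\<dots> = int k ^ 2 + (\<Sum>(u, v)\<in>?P. chi ((2 * t + (u + v)) * b - a\<^sup>2) * chi ((t + u) * (t + v)))"
    by (simp add: case_prod_beta sum.distrib power2_eq_square chi_mult mult_ac)
  also have "\<dots> = int k ^ 2 + (\<Sum>s\<in>{2..2 * int k}. chi ((2 * t + s) * b - a\<^sup>2) * chi_convolution k t s)"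
    using sum_chi_convolution[of "\<lambda>s. chi ((2 * t + s) * b - a\<^sup>2)" k t] by simp
  also have "(\<Sum>s\<in>{2..2 * int k}. chi ((2 * t + s) * b - a\<^sup>2) * chi_convolution k t s)
      \<le> (\<Sum>s\<in>{2..2 * int k}. \<bar>chi_convolution k t s\<bar>)"
  proof (rule sum_mono)
    fix s
    show "chi ((2 * t + s) * b - a\<^sup>2) * chi_convolution k t s \<le> \<bar>chi_convolution k t s\<bar>"
      using chi_cases[of "(2 * t + s) * b - a\<^sup>2"] by auto
  qed
  finally show ?thesis by simp
qed

lemma exists_sidon_set:
  assumes k: "k > 0" and p2k: "p > 2 * int k"
    and large: "real_of_int p > 3 * real k * (2 * real k ^ 2 - real k + 1) + 4 * real k ^ 4 * real_of_int p powr (3/4)"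
  shows "\<exists>A. A \<subseteq> carrier (Zp_squared (nat p)) \<and> card A = k * nat p - k + 1 \<and>
         g_sidon (Zp_squared (nat p)) (nat \<lfloor>real k ^ 2 + 2 * real k powr (3 / 2)\<rfloor>) A"
proof -
  obtain t where t: "\<forall>u\<in>{1..int k}. \<not> p dvd t + u" "\<forall>s\<in>{2..2 * int k}. \<not> p dvd 2 * t + s"
    and V: "(\<Sum>s\<in>{2..2 * int k}. (chi_convolution k t s)\<^sup>2) \<le> 2 * int k ^ 2 - int k"
    using exists_good_shift[OF assms] by blast
  have sub: "parabolas k t \<subseteq> Fp \<times> Fp" by (auto simp: parabolas_def)
  then have fin: "finite (parabolas k t)" by (rule finite_subset) simp
  have "finite (rep_pairs (Zp_squared (nat p)) (parabolas k t) x)" for x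
    by (rule finite_subset[of _ "parabolas k t \<times> parabolas k t"]) (auto simp: rep_pairs_def fin)
  moreover have "card (rep_pairs (Zp_squared (nat p)) (parabolas k t) x) \<le> nat \<lfloor>real k ^ 2 + 2 * real k powr (3 / 2)\<rfloor>"
    if x: "x \<in> carrier (Zp_squared (nat p))" for x
  proof -
    obtain a b where ab: "x = (a, b)" "a \<in> Fp" "b \<in> Fp" using x by (auto simp: carrier_Zp_squared)
    have "real_of_int (int (card (rep_pairs (Zp_squared (nat p)) (parabolas k t) x)))
        \<le> real_of_int (int k ^ 2 + (\<Sum>s\<in>{2..2 * int k}. \<bar>chi_convolution k t s\<bar>))"
      unfolding of_int_le_iff ab(1) by (rule card_rep_pairs_parabolas_le[OF t ab(2,3)])
    also have "\<dots> \<le> real k ^ 2 + 2 * real k powr (3 / 2)"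
      using sum_abs_chi_convolution_le[OF k V] by simp
    finally show ?thesis by (intro le_nat_floor) simp
  qed
  ultimately show ?thesis
    using sub card_parabolas[OF p2k k t(1)] unfolding g_sidon_def carrier_Zp_squared by blast
qed

end

section \<open>The threshold for the prime\<close>

theorem theorem4:
  fixes k :: nat
  assumes "k > 0"
  shows "\<exists>p\<^sub>0 :: nat. \<forall>p :: nat. prime p \<and> p \<ge> p\<^sub>0 \<longrightarrow>
    (\<exists>A. A \<subseteq> carrier (Zp_squared p) \<and> card A = k * p - k + 1 \<and>
         g_sidon (Zp_squared p) (nat \<lfloor>real k ^ 2 + 2 * real k powr (3 / 2)\<rfloor>) A)"
proof -
  \<comment> \<open>The right side of the largeness condition is less than
    \<open>K * p powr (3/4)\<close>, the final 1 making this strict; and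
    \<open>p \<ge> K ^ 4\<close> gives \<open>K \<le> p powr (1/4)\<close>.\<close>
  define K where "K = 3 * k * (2 * k\<^sup>2 + 1) + 4 * k ^ 4 + 1"
  have "\<exists>A. A \<subseteq> carrier (Zp_squared p) \<and> card A = k * p - k + 1 \<and>
         g_sidon (Zp_squared p) (nat \<lfloor>real k ^ 2 + 2 * real k powr (3 / 2)\<rfloor>) A"
    if p: "prime p" "p \<ge> K ^ 4" for p
  proof -
    have kK: "3 * k \<le> K" "1 \<le> K" by (auto simp: K_def)
    have "K \<le> K ^ 4" by (rule self_le_power) (use kK in auto)
    then have Kp: "K \<le> p" using p by simp
    interpret odd_prime_modulus "int p"
    proof
      show "prime (int p)" using p by simp
      show "2 < int p" using Kp kK assms by linarith
    qed
    define q where "q = real p powr (3/4)"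
    have q1: "1 \<le> q" unfolding q_def using Kp kK by (intro ge_one_powr_ge_zero) auto
    have "real (K ^ 4) = real K powr 4" using kK by (simp add: powr_numeral)
    then have "real K = real (K ^ 4) powr (1/4)" by (simp only: powr_powr) simp
    also have "\<dots> \<le> real p powr (1/4)" using p by (intro powr_mono2) (simp_all flip: of_nat_power)
    finally have "real K * q \<le> real p powr (1/4) * q" using q1 by (intro mult_right_mono) auto
    also have "\<dots> = real p" unfolding q_def using Kp kK by (simp flip: powr_add)
    finally have Kq: "real K * q \<le> real p" .
    have "3 * real k * (2 * real k ^ 2 - real k + 1) \<le> 3 * real k * (2 * real k ^ 2 + 1)"
      by (intro mult_left_mono) auto
    also have "\<dots> \<le> 3 * real k * (2 * real k ^ 2 + 1) * q"
      using mult_left_mono[OF q1, of "3 * real k * (2 * real k ^ 2 + 1)"] by simp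
    finally have "3 * real k * (2 * real k ^ 2 - real k + 1) + 4 * real k ^ 4 * q < real K * q"
      using q1 by (simp add: K_def algebra_simps)
    then have "real_of_int (int p) > 3 * real k * (2 * real k ^ 2 - real k + 1)
        + 4 * real k ^ 4 * real_of_int (int p) powr (3/4)"
      using Kq by (simp add: q_def)
    moreover have "int p > 2 * int k" using Kp kK assms by linarith
    ultimately show ?thesis using exists_sidon_set[OF assms] by simp
  qed
  then show ?thesis by blast
qed

end
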